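(* Let $L>0$ and let $\mu$ be a log-concave probability measure on $\mathbb{R}$ with mean zero and $\mathrm{Supp}(\mu)\subseteq[-L,L]$. Let $T_\mu$ be the stopping time defined in the context. Then $$T_\mu\le 2L^2$$ almost surely.
   Context: $\mathrm{Supp}(\mu)$ is the minimal closed set of full $\mu$-measure. A measure $\mu$ on $\mathbb{R}$ is log-concave if it is either a Dirac measure or has a density with respect to Lebesgue measure of the form $e^{-\Phi(x)}$ with $\Phi:\mathbb{R}\to\mathbb{R}\cup\{+\infty\}$ convex. Definition of $T_\mu$. Let $\mu$ be a Borel probability measure on $\mathbb{R}$ with mean zero and finite second moment. For $b\ge 0$, $c\in\mathbb{R}$ set (whenever the integrals converge; in particular for $b>0$ and for $(b,c)=(0,0)$) $$V_\mu(b,c)=\int_{\mathbb{R}} e^{cx-\frac12 bx^2}\mu(dx),\qquad a_\mu(b,c)=V_\mu(b,c)^{-1}\int_{\mathbb{R}} x\,e^{cx-\frac12 bx^2}\mu(dx),$$ $$A_\mu(b,c)=V_\mu(b,c)^{-1}\int_{\mathbb{R}}(x-a_\mu(b,c))^2e^{cx-\frac12 bx^2}\mu(dx).$$ Let $W_t$ be a standard Wiener process and consider the system of stochastic differential equations $$c_0=0,\quad dc_t=A_\mu^{-1}(b_t,c_t)\,dW_t+A_\mu^{-2}(b_t,c_t)\,a_\mu(b_t,c_t)\,dt,\qquad b_0=0,\quad db_t=A_\mu^{-2}(b_t,c_t)\,dt.$$ This system has a unique maximal solution, with $b_t>0$ for $t>0$. $T_\mu$ is the supremum of the set of times up to which the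 solution exists ($T_\mu=\infty$ if it exists for all $t\ge 0$); equivalently, almost surely, the solution exists exactly on $[0,T_\mu)$ and $T_\mu=\sup\{t\ge 0:\ A_\mu(b_t,c_t)>0\}$. If $\mu=\delta_0$, then $T_\mu=0$. *)

theory Defs
  imports "HOL-Probability.Probability"
begin

subsection \<open>Log-concave measures and supports\<close>

definition measure_support :: "'a::topological_space measure \<Rightarrow> 'a set" where
  "measure_support \<mu> = \<Inter> {C. closed C \<and> emeasure \<mu> (space \<mu> - C) = 0}"

definition ereal_convex :: "(real \<Rightarrow> ereal) \<Rightarrow> bool" where
  "ereal_convex \<Phi> \<longleftrightarrow>
     (\<forall>x. \<Phi> x \<noteq> -\<infinity>) \<and>
     (\<forall>x y u v. 0 < u \<longrightarrow> 0 < v \<longrightarrow> u + v = 1 \<longrightarrow>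
        \<Phi> (u * x + v * y) \<le> ereal u * \<Phi> x + ereal v * \<Phi> y)"

definition exp_minus :: "ereal \<Rightarrow> real" where
  "exp_minus z = (if z = \<infinity> then 0 else exp (- real_of_ereal z))"

definition log_concave_measure :: "real measure \<Rightarrow> bool" where
  "log_concave_measure \<mu> \<longleftrightarrow>
     (\<exists>x. \<mu> = return borel x) \<or>
     (\<exists>\<Phi>. ereal_convex \<Phi> \<and> \<mu> = density lborel (\<lambda>x. ennreal (exp_minus (\<Phi> x))))"

subsection \<open>Gaussian tilts\<close>

text \<open>Divergent Bochner integrals have the value 0, so \<open>tilt_var \<mu> b c > 0\<close> implies that
  all three integrals converge.\<close>

definition tilt_V :: "real measure \<Rightarrow> real \<Rightarrow> real \<Rightarrow> real" where
  "tilt_V \<mu> b c = (\<integral>x. exp (c * x - b * x\<^sup>2 / 2) \<partial>\<mu>)"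

definition tilt_mean :: "real measure \<Rightarrow> real \<Rightarrow> real \<Rightarrow> real" where
  "tilt_mean \<mu> b c = inverse (tilt_V \<mu> b c) * (\<integral>x. x * exp (c * x - b * x\<^sup>2 / 2) \<partial>\<mu>)"

definition tilt_var :: "real measure \<Rightarrow> real \<Rightarrow> real \<Rightarrow> real" where
  "tilt_var \<mu> b c = inverse (tilt_V \<mu> b c) *
     (\<integral>x. (x - tilt_mean \<mu> b c)\<^sup>2 * exp (c * x - b * x\<^sup>2 / 2) \<partial>\<mu>)"

subsection \<open>Filtered probability spaces and Wiener processes\<close>

text \<open>Filtrations are indexed by \<open>[0,\<infinity>]\<close> (type \<open>ennreal\<close>), so that stopping times in the sense
  of the library may be infinite. Processes are indexed by \<open>real\<close>, and only their values at
  times \<open>t \<ge> 0\<close> matter.\<close>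

definition filtered_prob_space :: "'a measure \<Rightarrow> (ennreal \<Rightarrow> 'a measure) \<Rightarrow> bool" where
  "filtered_prob_space M F \<longleftrightarrow>
     prob_space M \<and> filtration (space M) F \<and> (\<forall>t. subalgebra M (F t)) \<and>
     null_sets M \<subseteq> sets (F 0) \<and>
     (\<forall>t<\<infinity>. sets (F t) = (\<Inter>s\<in>{t<..}. sets (F s)))"

definition wiener_process ::
    "'a measure \<Rightarrow> (ennreal \<Rightarrow> 'a measure) \<Rightarrow> (real \<Rightarrow> 'a \<Rightarrow> real) \<Rightarrow> bool" where
  "wiener_process M F W \<longleftrightarrow>
     (\<forall>t\<ge>0. W t \<in> borel_measurable (F (ennreal t))) \<and>
     (AE \<omega> in M. W 0 \<omega> = 0 \<and> continuous_on {0..} (\<lambda>t. W t \<omega>)) \<and>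
     (\<forall>s t. 0 \<le> s \<longrightarrow> s < t \<longrightarrow>
        distributed M lborel (\<lambda>\<omega>. W t \<omega> - W s \<omega>) (normal_density 0 (sqrt (t - s))) \<and>
        prob_space.indep_set M (sets (F (ennreal s)))
          {(\<lambda>\<omega>. W t \<omega> - W s \<omega>) -` B \<inter> space M | B. B \<in> sets borel})"

subsection \<open>The Ito integral\<close>

definition simple_integrand ::
    "'a measure \<Rightarrow> (ennreal \<Rightarrow> 'a measure) \<Rightarrow> nat \<Rightarrow> (nat \<Rightarrow> real) \<Rightarrow> (nat \<Rightarrow> 'a \<Rightarrow> real) \<Rightarrow> bool" where
  "simple_integrand M F n p \<xi> \<longleftrightarrow>
     0 \<le> p 0 \<and> (\<forall>i<n. p i \<le> p (Suc i)) \<and>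
     (\<forall>i<n. \<xi> i \<in> borel_measurable (F (ennreal (p i))) \<and> (\<exists>K. \<forall>\<omega>\<in>space M. \<bar>\<xi> i \<omega>\<bar> \<le> K))"

definition simple_value ::
    "nat \<Rightarrow> (nat \<Rightarrow> real) \<Rightarrow> (nat \<Rightarrow> 'a \<Rightarrow> real) \<Rightarrow> real \<Rightarrow> 'a \<Rightarrow> real" where
  "simple_value n p \<xi> s \<omega> = (\<Sum>i<n. \<xi> i \<omega> * indicator {p i<..p (Suc i)} s)"

definition simple_integral ::
    "(real \<Rightarrow> 'a \<Rightarrow> real) \<Rightarrow> nat \<Rightarrow> (nat \<Rightarrow> real) \<Rightarrow> (nat \<Rightarrow> 'a \<Rightarrow> real) \<Rightarrow> real \<Rightarrow> 'a \<Rightarrow> real" where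
  "simple_integral W n p \<xi> t \<omega> =
     (\<Sum>i<n. \<xi> i \<omega> * (W (min (p (Suc i)) t) \<omega> - W (min (p i) t) \<omega>))"

definition progressively_measurable ::
    "(ennreal \<Rightarrow> 'a measure) \<Rightarrow> (real \<Rightarrow> 'a \<Rightarrow> real) \<Rightarrow> bool" where
  "progressively_measurable F H \<longleftrightarrow>
     (\<forall>t\<ge>0. (\<lambda>(s, \<omega>). indicator {0..t} s * H s \<omega>) \<in> borel_measurable (borel \<Otimes>\<^sub>M F (ennreal t)))"

text \<open>\<open>has_ito_integral M F W H t J\<close> says that \<open>J\<close> is a version of the Ito integral of \<open>H\<close> against
  \<open>W\<close> over \<open>[0,t]\<close>: the limit in probability of the integrals of simple integrands that converge
  to \<open>H\<close> in \<open>L\<^sup>2[0,t]\<close> in probability. Such a \<open>J\<close> exists iff the progressively measurable \<open>H\<close> is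
  almost surely square integrable on \<open>[0,t]\<close>, and is then unique up to null sets.\<close>

definition has_ito_integral ::
    "'a measure \<Rightarrow> (ennreal \<Rightarrow> 'a measure) \<Rightarrow> (real \<Rightarrow> 'a \<Rightarrow> real) \<Rightarrow>
     (real \<Rightarrow> 'a \<Rightarrow> real) \<Rightarrow> real \<Rightarrow> ('a \<Rightarrow> real) \<Rightarrow> bool" where
  "has_ito_integral M F W H t J \<longleftrightarrow>
     progressively_measurable F H \<and> J \<in> borel_measurable M \<and>
     (\<exists>n p \<xi>. (\<forall>k. simple_integrand M F (n k) (p k) (\<xi> k)) \<and>
       (\<forall>\<epsilon>>0. (\<lambda>k. measure M {\<omega> \<in> space M.
          ennreal \<epsilon> < (\<integral>\<^sup>+s\<in>{0..t}. ennreal ((simple_value (n k) (p k) (\<xi> k) s \<omega> - H s \<omega>)\<^sup>2) \<partial>lborel)})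
          \<longlonglongrightarrow> 0) \<and>
       (\<forall>\<epsilon>>0. (\<lambda>k. measure M {\<omega> \<in> space M.
          \<epsilon> < \<bar>simple_integral W (n k) (p k) (\<xi> k) t \<omega> - J \<omega>\<bar>}) \<longlonglongrightarrow> 0))"

subsection \<open>The stochastic differential equation and its lifetime\<close>

text \<open>\<open>local_solution M F W \<mu> T b c\<close> says that \<open>(b, c)\<close> solves the system on the stochastic interval
  \<open>[0,T)\<close>; the values of \<open>b\<close> and \<open>c\<close> from time \<open>T\<close> on are irrelevant, and \<open>T = 0\<close> (empty interval)
  is allowed. As usual for solutions up to a lifetime, the equation of \<open>c\<close> is required up to each
  member of a sequence of stopping times that announces \<open>T\<close>.\<close>

definition local_solution ::
    "'a measure \<Rightarrow> (ennreal \<Rightarrow> 'a measure) \<Rightarrow> (real \<Rightarrow> 'a \<Rightarrow> real) \<Rightarrow> real measure \<Rightarrow>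
     ('a \<Rightarrow> ennreal) \<Rightarrow> (real \<Rightarrow> 'a \<Rightarrow> real) \<Rightarrow> (real \<Rightarrow> 'a \<Rightarrow> real) \<Rightarrow> bool" where
  "local_solution M F W \<mu> T b c \<longleftrightarrow>
     stopping_time F T \<and>
     (\<forall>t\<ge>0. (\<lambda>\<omega>. if ennreal t < T \<omega> then b t \<omega> else 0) \<in> borel_measurable (F (ennreal t))) \<and>
     (\<forall>t\<ge>0. (\<lambda>\<omega>. if ennreal t < T \<omega> then c t \<omega> else 0) \<in> borel_measurable (F (ennreal t))) \<and>
     (\<forall>\<omega>\<in>space M.
        continuous_on {t. 0 \<le> t \<and> ennreal t < T \<omega>} (\<lambda>t. b t \<omega>) \<and>
        continuous_on {t. 0 \<le> t \<and> ennreal t < T \<omega>} (\<lambda>t. c t \<omega>) \<and>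
        (\<forall>t\<ge>0. ennreal t < T \<omega> \<longrightarrow> 0 \<le> b t \<omega> \<and> 0 < tilt_var \<mu> (b t \<omega>) (c t \<omega>))) \<and>
     (AE \<omega> in M. 0 < T \<omega> \<longrightarrow> b 0 \<omega> = 0 \<and> c 0 \<omega> = 0) \<and>
     (AE \<omega> in M. \<forall>t\<ge>0. ennreal t < T \<omega> \<longrightarrow>
        ((\<lambda>s. inverse ((tilt_var \<mu> (b s \<omega>) (c s \<omega>))\<^sup>2)) has_integral b t \<omega>) {0..t}) \<and>
     (\<exists>\<tau>. (\<forall>n. stopping_time F (\<tau> n)) \<and>
        (AE \<omega> in M. incseq (\<lambda>n. \<tau> n \<omega>) \<and> (\<lambda>n. \<tau> n \<omega>) \<longlonglongrightarrow> T \<omega> \<and>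
           (0 < T \<omega> \<longrightarrow> (\<forall>n. \<tau> n \<omega> < T \<omega>))) \<and>
        (\<forall>n. \<forall>t\<ge>0. \<exists>J.
           has_ito_integral M F W
             (\<lambda>s \<omega>. if ennreal s \<le> \<tau> n \<omega> \<and> ennreal s < T \<omega>
                     then inverse (tilt_var \<mu> (b s \<omega>) (c s \<omega>)) else 0) t J \<and>
           (AE \<omega> in M. 0 < T \<omega> \<longrightarrow>
              (let r = enn2real (min (ennreal t) (\<tau> n \<omega>)) in
               ((\<lambda>s. inverse ((tilt_var \<mu> (b s \<omega>) (c s \<omega>))\<^sup>2) * tilt_mean \<mu> (b s \<omega>) (c s \<omega>))
                  has_integral (c r \<omega> - J \<omega>)) {0..r}))))"

text \<open>\<open>T\<close> is the (almost surely unique) lifetime \<open>T\<^sub>\<mu>\<close> of the maximal solution: the solution exists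
  on \<open>[0,T)\<close>, and no solution lives longer.\<close>

definition solution_lifetime ::
    "'a measure \<Rightarrow> (ennreal \<Rightarrow> 'a measure) \<Rightarrow> (real \<Rightarrow> 'a \<Rightarrow> real) \<Rightarrow> real measure \<Rightarrow>
     ('a \<Rightarrow> ennreal) \<Rightarrow> bool" where
  "solution_lifetime M F W \<mu> T \<longleftrightarrow>
     (\<exists>b c. local_solution M F W \<mu> T b c) \<and>
     (\<forall>T' b' c'. local_solution M F W \<mu> T' b' c' \<longrightarrow> (AE \<omega> in M. T' \<omega> \<le> T \<omega>))"

end

(* The bound is pathwise and only uses b' = A^(-2). A measure supported in [-L,L] has A <= L^2, and
   strong log-concavity of the tilted measure gives A <= 1/b (Brascamp-Lieb). Hence
   b(L^2) >= 1/L^2, and from then on b' >= b^2 forces b to blow up within another time L^2. *)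
theory Submission
  imports Defs
begin

section \<open>Null sets and the support of a Borel measure\<close>

text \<open>The complement of the support is a union of possibly uncountably many open null sets. By
  Lindelof, countably many of them have the same union, so it is again null.\<close>

lemma emeasure_compl_measure_support:
  fixes \<mu> :: "'a::second_countable_topology measure"
  assumes sets: "sets \<mu> = sets borel"
  shows "emeasure \<mu> (- measure_support \<mu>) = 0"
proof -
  have sp: "space \<mu> = UNIV"
    using sets_eq_imp_space_eq[OF sets] by simp
  define \<C> where "\<C> = {C. closed C \<and> emeasure \<mu> (space \<mu> - C) = 0}"
  obtain \<F> where \<F>: "\<F> \<subseteq> uminus ` \<C>" "countable \<F>" "\<Union>\<F> = \<Union>(uminus ` \<C>)"
    by (rule Lindelof[of "uminus ` \<C>"]) (auto simp: \<C>_def)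
  have "(\<Union>U\<in>\<F>. U) \<in> null_sets \<mu>"
  proof (rule null_sets_UN'[OF \<F>(2)])
    fix U assume "U \<in> \<F>"
    then obtain C where "C \<in> \<C>" "U = - C" using \<F>(1) by auto
    then show "U \<in> null_sets \<mu>"
      by (intro null_setsI) (auto simp: \<C>_def sp sets Compl_eq_Diff_UNIV[symmetric])
  qed
  moreover have "(\<Union>U\<in>\<F>. U) = - measure_support \<mu>"
    using \<F>(3) by (auto simp: measure_support_def \<C>_def)
  ultimately show ?thesis by auto
qed

lemma AE_mem_of_measure_support_subset:
  fixes \<mu> :: "'a::second_countable_topology measure"
  assumes sets: "sets \<mu> = sets borel" and K: "measure_support \<mu> \<subseteq> K"
  shows "AE x in \<mu>. x \<in> K"
proof (rule AE_I')
  have "closed (measure_support \<mu>)"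
    by (auto simp: measure_support_def)
  then show "- measure_support \<mu> \<in> null_sets \<mu>"
    by (intro null_setsI emeasure_compl_measure_support[OF sets]) (auto simp: sets)
qed (use K in auto)

section \<open>Derivatives integrated against unimodal functions\<close>

text \<open>Strict superlevel sets are intervals, hence Borel. This gives measurability of functions
  that are known only through convexity or monotonicity.\<close>

lemma borel_measurable_quasiconcave:
  fixes f :: "real \<Rightarrow> real"
  assumes "\<And>x y z. x \<le> z \<Longrightarrow> z \<le> y \<Longrightarrow> min (f x) (f y) \<le> f z"
  shows "f \<in> borel_measurable borel"
proof (subst borel_measurable_iff_greater, safe)
  fix u
  have "is_interval {x. u < f x}"
    unfolding is_interval_1 by (smt (verit) assms mem_Collect_eq)
  then show "{w \<in> space borel. u < f w} \<in> sets borel"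
    by (simp add: real_interval_borel_measurable)
qed

text \<open>Up to endpoints, a nonempty \<open>S\<close> is an interval from \<open>p\<close> to
  \<open>q\<close> with \<open>p\<close> \<le> \<open>a\<close> \<le> \<open>q\<close>. The integral
  is therefore \<open>H q - H p\<close>, and the sign change of \<open>H\<close> at \<open>a\<close>
  makes both terms contribute nonnegatively.\<close>

lemma integral_deriv_interval_nonneg:
  fixes H h :: "real \<Rightarrow> real"
  assumes deriv: "\<And>x. (H has_field_derivative h x) (at x)"
    and cont: "continuous_on UNIV h"
    and pos: "\<And>x. a \<le> x \<Longrightarrow> 0 \<le> H x" and neg: "\<And>x. x \<le> a \<Longrightarrow> H x \<le> 0"
    and S: "is_interval S" "S \<subseteq> {l..r}" "S \<noteq> {} \<Longrightarrow> a \<in> S"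
  shows "0 \<le> (\<integral>x. h x * indicator S x \<partial>lborel)"
proof (cases "S = {}")
  case False
  then have aS: "a \<in> S" by (rule S(3))
  have bdd: "bdd_below S" "bdd_above S"
    using S(2) by (meson bdd_below_Icc bdd_below_mono, meson bdd_above_Icc bdd_above_mono)
  define p q where "p = Inf S" and "q = Sup S"
  have pq: "p \<le> a" "a \<le> q"
    unfolding p_def q_def using aS bdd by (auto intro: cInf_lower cSup_upper)
  have S_pq: "S \<subseteq> {p..q}"
    unfolding p_def q_def using bdd by (auto intro: cInf_lower cSup_upper)
  have pq_S: "x \<in> S" if "p < x" "x < q" for x
  proof -
    obtain y where "y \<in> S" "y < x"
      using cInf_lessD[OF False \<open>p < x\<close>[unfolded p_def]] by blast
    moreover obtain z where "z \<in> S" "x < z"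
      using less_cSupD[OF False \<open>x < q\<close>[unfolded q_def]] by blast
    ultimately show ?thesis using S(1) unfolding is_interval_1 by (meson less_imp_le)
  qed
  \<comment> \<open>\<open>S\<close> may or may not contain \<open>p\<close> and \<open>q\<close>;
    two points do not affect a Lebesgue integral, and the closed interval suits the fundamental
    theorem of calculus.\<close>
  have "(\<integral>x. h x * indicator S x \<partial>lborel) = (\<integral>x. h x * indicator {p..q} x \<partial>lborel)"
  proof (rule integral_cong_AE)
    have [measurable]: "h \<in> borel_measurable borel"
      using cont by (rule borel_measurable_continuous_onI)
    have [measurable]: "S \<in> sets borel"
      using S(1) by (rule real_interval_borel_measurable)
    show "(\<lambda>x. h x * indicator S x) \<in> borel_measurable lborel"
      and "(\<lambda>x. h x * indicator {p..q} x) \<in> borel_measurable lborel"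
      by measurable
    have "AE x in lborel. x \<noteq> p" "AE x in lborel. x \<noteq> q"
      by (rule AE_lborel_singleton)+
    then show "AE x in lborel. h x * indicator S x = h x * indicator {p..q} x"
    proof eventually_elim
      case (elim x)
      then show ?case
        using S_pq pq_S[of x] by (auto simp: indicator_def)
    qed
  qed
  also have "\<dots> = H q - H p"
    using pq deriv cont
    by (intro integral_FTC_Icc_real) (auto simp: continuous_on_eq_continuous_at)
  also have "\<dots> \<ge> 0"
    using pos[OF pq(2)] neg[OF pq(1)] by simp
  finally show ?thesis .
qed simp

text \<open>Layer cake: \<open>g\<close> is a superposition of indicators of intervals containing \<open>a\<close>.\<close>

lemma integral_deriv_unimodal_nonneg:
  fixes H h g :: "real \<Rightarrow> real"
  assumes deriv: "\<And>x. (H has_field_derivative h x) (at x)"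
    and cont: "continuous_on UNIV h"
    and pos: "\<And>x. a \<le> x \<Longrightarrow> 0 \<le> H x" and neg: "\<And>x. x \<le> a \<Longrightarrow> H x \<le> 0"
    and g_nonneg: "\<And>x. 0 \<le> g x" and g_zero: "\<And>x. x \<notin> {l..r} \<Longrightarrow> g x = 0"
    and dec: "\<And>x y. a \<le> x \<Longrightarrow> x \<le> y \<Longrightarrow> g y \<le> g x"
    and inc: "\<And>x y. x \<le> y \<Longrightarrow> y \<le> a \<Longrightarrow> g x \<le> g y"
  shows "0 \<le> (\<integral>x. h x * g x \<partial>lborel)"
proof -
  have [measurable]: "h \<in> borel_measurable borel"
    using cont by (rule borel_measurable_continuous_onI)
  have g_a: "g x \<le> g a" for x
    using dec[of a x] inc[of x a] by linarith
  have quasi: "min (g x) (g y) \<le> g z" if "x \<le> z" "z \<le> y" for x y z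
    using that dec[of z y] inc[of x z] by linarith
  have [measurable]: "g \<in> borel_measurable borel"
    using quasi by (rule borel_measurable_quasiconcave)
  \<comment> \<open>The layer-cake kernel: integrated over \<open>u\<close> it gives
    \<open>h x * g x\<close>, and integrated over \<open>x\<close> at a level \<open>u\<close> \<ge>
    0 it gives the integral of \<open>h\<close> over the superlevel set of \<open>g\<close>.\<close>
  define k where "k x u = h x * indicator {0..<g x} u" for x u
  obtain B where B: "\<And>x. x \<in> {l..r} \<Longrightarrow> norm (h x) \<le> B"
  proof -
    have "compact (h ` {l..r})"
      using cont by (intro compact_continuous_image continuous_on_subset[OF cont]) auto
    then show ?thesis
      using that by (meson bounded_iff compact_imp_bounded imageI)
  qed
  \<comment> \<open>Fubini applies because the kernel is bounded and lives on the rectangle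
    \<open>{l..r} \<times> {0..g a}\<close>, \<open>g a\<close> being the maximum of
    \<open>g\<close>.\<close>
  have int: "integrable (lborel \<Otimes>\<^sub>M lborel) (case_prod k)"
  proof (rule integrableI_bounded_set[where A = "{l..r} \<times> {0..g a}" and B = B])
    have "emeasure (lborel \<Otimes>\<^sub>M lborel) ({l..r} \<times> {0..g a})
        = emeasure lborel {l..r} * emeasure lborel {0..g a}"
      by (intro lborel.emeasure_pair_measure_Times) auto
    then show "emeasure (lborel \<Otimes>\<^sub>M lborel) ({l..r} \<times> {0..g a}) < \<infinity>"
      by (auto simp: ennreal_mult_less_top emeasure_lborel_Icc_eq)
    show "case_prod k \<in> borel_measurable (lborel \<Otimes>\<^sub>M lborel)"
      unfolding k_def atLeastLessThan_iff indicator_def case_prod_beta by measurable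
    show "AE z in lborel \<Otimes>\<^sub>M lborel. z \<in> {l..r} \<times> {0..g a} \<longrightarrow> norm (case_prod k z) \<le> B"
    proof (rule AE_I2, safe)
      fix x u assume "x \<in> {l..r}"
      from B[OF this] show "norm (k x u) \<le> B"
        by (auto simp: k_def indicator_def)
    qed
    have "k x u = 0" if "(x, u) \<notin> {l..r} \<times> {0..g a}" for x u
      using that g_zero[of x] g_a[of x] by (auto simp: k_def indicator_def)
    then show "AE z in lborel \<Otimes>\<^sub>M lborel. z \<notin> {l..r} \<times> {0..g a} \<longrightarrow> case_prod k z = 0"
      by (intro AE_I2 impI) (metis case_prod_beta prod.collapse)
  qed auto
  have "0 \<le> (\<integral>u. (\<integral>x. k x u \<partial>lborel) \<partial>lborel)"
  proof (rule Bochner_Integration.integral_nonneg)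
    fix u :: real
    show "0 \<le> (\<integral>x. k x u \<partial>lborel)"
    \<comment> \<open>At negative levels the superlevel set is the whole line and not contained in
      \<open>{l..r}\<close>, but there the kernel is 0.\<close>
    proof (cases "u < 0")
      case True
      then show ?thesis by (simp add: k_def)
    next
      case False
      have "0 \<le> (\<integral>x. h x * indicator {x. u < g x} x \<partial>lborel)"
      proof (rule integral_deriv_interval_nonneg[OF deriv cont pos neg])
        show "is_interval {x. u < g x}"
          unfolding is_interval_1 using quasi by (smt (verit) mem_Collect_eq)
        show "{x. u < g x} \<subseteq> {l..r}"
          using g_zero False by (metis mem_Collect_eq subsetI)
        show "{x. u < g x} \<noteq> {} \<Longrightarrow> a \<in> {x. u < g x}"
          using g_a by (auto intro: less_le_trans)
      qed
      also have "\<dots> = (\<integral>x. k x u \<partial>lborel)"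
        using False by (intro Bochner_Integration.integral_cong) (auto simp: k_def indicator_def)
      finally show ?thesis .
    qed
  qed
  also have "\<dots> = (\<integral>x. (\<integral>u. k x u \<partial>lborel) \<partial>lborel)"
    using int by (rule lborel_pair.Fubini_integral)
  also have "\<dots> = (\<integral>x. h x * g x \<partial>lborel)"
    using g_nonneg by (simp add: k_def)
  finally show ?thesis .
qed

section \<open>Finite-time blow-up for a Riccati inequality in integral form\<close>

lemma riccati_blow_up:
  fixes L :: real and b g :: "real \<Rightarrow> real"
  assumes L: "L > 0"
    and cont: "continuous_on {0..2 * L\<^sup>2} b"
    and b: "\<And>t. t \<in> {0..2 * L\<^sup>2} \<Longrightarrow> (g has_integral b t) {0..t}"
    and g_ge: "\<And>t. t \<in> {0..2 * L\<^sup>2} \<Longrightarrow> 1 / L ^ 4 \<le> g t"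
    and g_sq: "\<And>t. t \<in> {0..2 * L\<^sup>2} \<Longrightarrow> (b t)\<^sup>2 \<le> g t"
  shows False
proof -
  define t0 t1 where "t0 = L\<^sup>2" and "t1 = 2 * L\<^sup>2"
  have t: "0 < t0" "t0 \<le> t1" "t1 - t0 = t0" "t0 \<in> {0..2 * L\<^sup>2}"
    using L by (auto simp: t0_def t1_def)
  \<comment> \<open>First half of the time: the constant lower bound integrates to
    \<open>1 / L\<^sup>2\<close>, which is \<open>1 / t0\<close>.\<close>
  have "((\<lambda>s. 1 / L ^ 4) has_integral (1 / L ^ 4) * (t0 - 0)) {0..t0}"
    using has_integral_const_real[of "1 / L ^ 4" 0 t0] t by (simp add: mult.commute)
  then have "(1 / L ^ 4) * (t0 - 0) \<le> b t0"
    using b[OF t(4)] by (rule has_integral_le) (use g_ge t in \<open>auto simp: t1_def\<close>)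
  then have b0: "1 / t0 \<le> b t0"
    using L by (simp add: t0_def field_simps power4_eq_xxxx power2_eq_square)
  \<comment> \<open>Second half: \<open>g\<close> is not assumed continuous, so \<open>b\<close>
    need not be differentiable. The minorant \<open>B\<close> has the continuous derivative
    \<open>b\<^sup>2\<close>, and \<open>B\<close> \<le> \<open>b\<close> turns this into B' \<ge>
    B^2.\<close>
  define B where "B t = b t0 + integral {t0..t} (\<lambda>s. (b s)\<^sup>2)" for t
  have cont': "continuous_on {t0..t1} b"
    using t by (intro continuous_on_subset[OF cont]) (auto simp: t1_def)
  have contsq: "continuous_on {t0..t1} (\<lambda>s. (b s)\<^sup>2)"
    using cont' by (intro continuous_intros)
  have B_le: "B t \<le> b t" if "t \<in> {t0..t1}" for t
  proof -
    have tt: "t \<in> {0..2 * L\<^sup>2}" using that t by (auto simp: t1_def)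
    have "g integrable_on {t0..t}"
      using b[OF tt] that t by (meson atLeastAtMost_iff has_integral_integrable
        integrable_on_subinterval atLeastatMost_subset_iff less_imp_le order_refl)
    then have gi: "(g has_integral integral {t0..t} g) {t0..t}"
      by (rule integrable_integral)
    have "(g has_integral (b t0 + integral {t0..t} g)) {0..t}"
      using t that by (intro has_integral_combine[OF _ _ b[OF t(4)] gi]) auto
    then have *: "b t = b t0 + integral {t0..t} g"
      using b[OF tt] by (rule has_integral_unique[symmetric])
    have "integral {t0..t} (\<lambda>s. (b s)\<^sup>2) \<le> integral {t0..t} g"
    proof (rule integral_le)
      show "(\<lambda>s. (b s)\<^sup>2) integrable_on {t0..t}"
        using that by (intro integrable_continuous_real continuous_on_subset[OF contsq]) auto
      show "g integrable_on {t0..t}" by fact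
    qed (use g_sq that t in \<open>auto simp: t1_def\<close>)
    with * show ?thesis by (simp add: B_def)
  qed
  have B_ge: "1 / t0 \<le> B t" if "t \<in> {t0..t1}" for t
  proof -
    have "0 \<le> integral {t0..t} (\<lambda>s. (b s)\<^sup>2)"
      by (rule integral_nonneg)
        (use that in \<open>auto intro!: integrable_continuous_real continuous_on_subset[OF contsq]\<close>)
    with b0 show ?thesis by (simp add: B_def)
  qed
  have B_pos: "0 < B t" if "t \<in> {t0..t1}" for t
    using B_ge[OF that] t(1) by (smt (verit) divide_pos_pos)
  \<comment> \<open>The Riccati inequality says that -1/B grows at least at unit speed, so
    \<open>G\<close> is nondecreasing.\<close>
  define G where "G s = - inverse (B s) - s" for s
  have "G t0 \<le> G t1"
  proof (rule DERIV_nonneg_imp_increasing_open[OF t(2)])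
    have "(B has_real_derivative (b s)\<^sup>2) (at s within {t0..t1})" if "s \<in> {t0..t1}" for s
      unfolding B_def has_real_derivative_iff_has_vector_derivative
      by (rule derivative_eq_intros integral_has_vector_derivative[OF contsq that] refl | simp)+
    then have G: "(G has_real_derivative ((b s)\<^sup>2 / (B s)\<^sup>2 - 1)) (at s within {t0..t1})"
      if "s \<in> {t0..t1}" for s
      using B_pos[OF that] that unfolding G_def
      by (auto intro!: derivative_eq_intros simp: power2_eq_square field_simps)
    then show "continuous_on {t0..t1} G"
      by (rule DERIV_continuous_on)
    show "\<exists>y. (G has_real_derivative y) (at s) \<and> 0 \<le> y" if "t0 < s" "s < t1" for s
    proof (intro exI conjI)
      have s: "s \<in> {t0..t1}" using that by simp
      show "(G has_real_derivative ((b s)\<^sup>2 / (B s)\<^sup>2 - 1)) (at s)"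
        using G[OF s] that by (simp add: at_within_Icc_at)
      show "0 \<le> (b s)\<^sup>2 / (B s)\<^sup>2 - 1"
        using B_pos[OF s] B_le[OF s] by (simp add: power_mono)
    qed
  qed
  \<comment> \<open>The second half also has length \<open>t0\<close>, which uses up all of
    \<open>inverse (B t0)\<close>; a positive \<open>B t1\<close> is then impossible.\<close>
  then have "inverse (B t1) \<le> inverse (B t0) - t0"
    using t(3) by (simp add: G_def)
  moreover have "inverse (B t0) \<le> t0"
    using B_ge[of t0] t B_pos[of t0] by (simp add: field_simps)
  ultimately show False
    using B_pos[of t1] t(2) by (smt (verit) atLeastAtMost_iff positive_imp_inverse_positive)
qed

section \<open>Moments of Gaussian tilts of a measure on a bounded interval\<close>

lemma integrable_continuous_AE_Icc:
  fixes f :: "real \<Rightarrow> real"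
  assumes "prob_space \<mu>" and sets: "sets \<mu> = sets borel" and supp: "AE x in \<mu>. x \<in> {l..r}"
    and f: "continuous_on UNIV f"
  shows "integrable \<mu> f"
proof -
  interpret prob_space \<mu> by fact
  have "compact (f ` {l..r})"
    by (intro compact_continuous_image continuous_on_subset[OF f]) auto
  then obtain B where B: "\<And>x. x \<in> {l..r} \<Longrightarrow> norm (f x) \<le> B"
    by (meson bounded_iff compact_imp_bounded imageI)
  show ?thesis
  proof (rule integrable_const_bound)
    show "AE x in \<mu>. norm (f x) \<le> B"
      using supp by eventually_elim (rule B)
    show "f \<in> borel_measurable \<mu>"
      using borel_measurable_continuous_onI[OF f] measurable_cong_sets[OF sets refl] by blast
  qed
qed

text \<open>Makes the \<open>inverse\<close> in \<open>tilt_mean\<close> and \<open>tilt_var\<close>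
  a genuine division, so that the normalization can be cancelled.\<close>

lemma tilt_V_pos:
  assumes "prob_space \<mu>" and "sets \<mu> = sets borel" and "AE x in \<mu>. x \<in> {l..r}"
  shows "0 < tilt_V \<mu> b c"
proof -
  interpret prob_space \<mu> by fact
  let ?w = "\<lambda>x::real. exp (c * x - b * x\<^sup>2 / 2)"
  have int: "integrable \<mu> ?w"
    by (rule integrable_continuous_AE_Icc[OF assms]) (auto intro!: continuous_intros)
  have "tilt_V \<mu> b c \<noteq> 0"
    unfolding tilt_V_def by (subst integral_nonneg_eq_0_iff_AE[OF int]) auto
  moreover have "0 \<le> tilt_V \<mu> b c"
    unfolding tilt_V_def by (intro Bochner_Integration.integral_nonneg) auto
  ultimately show ?thesis by simp
qed

lemma integral_tilt_centered:
  assumes "prob_space \<mu>" and "sets \<mu> = sets borel" and "AE x in \<mu>. x \<in> {l..r}"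
  shows "(\<integral>x. (x - tilt_mean \<mu> b c) * exp (c * x - b * x\<^sup>2 / 2) \<partial>\<mu>) = 0"
proof -
  let ?w = "\<lambda>x::real. exp (c * x - b * x\<^sup>2 / 2)" and ?a = "tilt_mean \<mu> b c"
  have int: "integrable \<mu> ?w" "integrable \<mu> (\<lambda>x. x * ?w x)"
    by (rule integrable_continuous_AE_Icc[OF assms]; auto intro!: continuous_intros)+
  have "(\<integral>x. (x - ?a) * ?w x \<partial>\<mu>) = (\<integral>x. x * ?w x \<partial>\<mu>) - ?a * tilt_V \<mu> b c"
    using int by (simp add: left_diff_distrib tilt_V_def)
  also have "\<dots> = 0"
    using tilt_V_pos[OF assms, of b c] by (simp add: tilt_mean_def)
  finally show ?thesis .
qed

lemma tilt_var_eq: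
  assumes "prob_space \<mu>" and "sets \<mu> = sets borel" and "AE x in \<mu>. x \<in> {l..r}"
  shows "(\<integral>x. (x - tilt_mean \<mu> b c)\<^sup>2 * exp (c * x - b * x\<^sup>2 / 2) \<partial>\<mu>)
    = tilt_var \<mu> b c * tilt_V \<mu> b c"
  using tilt_V_pos[OF assms, of b c] by (simp add: tilt_var_def)

text \<open>A variance is at most the second moment about 0, and x^2 \<le> L^2 almost
  everywhere.\<close>

lemma tilt_var_le_square:
  assumes "prob_space \<mu>" and "sets \<mu> = sets borel" and supp: "AE x in \<mu>. x \<in> {-L..L}"
  shows "tilt_var \<mu> b c \<le> L\<^sup>2"
proof -
  note \<mu> = assms
  let ?w = "\<lambda>x::real. exp (c * x - b * x\<^sup>2 / 2)" and ?a = "tilt_mean \<mu> b c"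
  have int: "integrable \<mu> ?w" "integrable \<mu> (\<lambda>x. (x - ?a) * ?w x)"
    "integrable \<mu> (\<lambda>x. x\<^sup>2 * ?w x)"
    by (rule integrable_continuous_AE_Icc[OF \<mu>]; auto intro!: continuous_intros)+
  have "tilt_var \<mu> b c * tilt_V \<mu> b c = (\<integral>x. (x - ?a)\<^sup>2 * ?w x \<partial>\<mu>)"
    by (rule tilt_var_eq[OF \<mu>, symmetric])
  \<comment> \<open>The expansion is arranged around \<open>x - ?a\<close>, so that the middle term
    integrates to 0 by centering.\<close>
  also have "\<dots> = (\<integral>x. x\<^sup>2 * ?w x - 2 * ?a * ((x - ?a) * ?w x) - ?a\<^sup>2 * ?w x \<partial>\<mu>)"
    by (intro Bochner_Integration.integral_cong) (auto simp: algebra_simps power2_eq_square)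
  also have "\<dots> = (\<integral>x. x\<^sup>2 * ?w x \<partial>\<mu>) - 2 * ?a * (\<integral>x. (x - ?a) * ?w x \<partial>\<mu>)
      - ?a\<^sup>2 * tilt_V \<mu> b c"
    using int by (simp add: tilt_V_def)
  also have "\<dots> \<le> (\<integral>x. x\<^sup>2 * ?w x \<partial>\<mu>)"
    using tilt_V_pos[OF \<mu>, of b c] by (simp add: integral_tilt_centered[OF \<mu>])
  also have "\<dots> \<le> (\<integral>x. L\<^sup>2 * ?w x \<partial>\<mu>)"
  proof (rule integral_mono_AE)
    show "AE x in \<mu>. x\<^sup>2 * ?w x \<le> L\<^sup>2 * ?w x"
      using supp
    proof eventually_elim
      case (elim x)
      then have "x\<^sup>2 \<le> L\<^sup>2" by (intro abs_le_square_iff[THEN iffD1]) auto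
      then show ?case by simp
    qed
  qed (use int in auto)
  also have "\<dots> = L\<^sup>2 * tilt_V \<mu> b c"
    by (simp add: tilt_V_def)
  finally show ?thesis
    using tilt_V_pos[OF \<mu>, of b c] by simp
qed

lemma tilt_var_return: "tilt_var (return borel x0) b c = 0"
  by (simp add: tilt_var_def tilt_mean_def tilt_V_def integral_return)

section \<open>Convex potentials and the Brascamp-Lieb bound for the tilted variance\<close>

text \<open>Passes from extended-valued convexity to \<open>convex_on\<close> for a real function on
  the effective domain, where supporting lines are available. The set \<open>S\<close> allows
  cutting the domain down to an interval.\<close>

lemma ereal_convex_domain:
  assumes "ereal_convex \<Phi>" and "convex S"
  defines "D \<equiv> {x \<in> S. \<Phi> x \<noteq> \<infinity>}"
  shows "convex D" and "convex_on D (\<lambda>x. real_of_ereal (\<Phi> x))"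
proof -
  have *: "\<Phi> (u * x + v * y) \<noteq> \<infinity> \<and>
      real_of_ereal (\<Phi> (u * x + v * y)) \<le> u * real_of_ereal (\<Phi> x) + v * real_of_ereal (\<Phi> y)"
    if "x \<in> D" "y \<in> D" "0 < u" "0 < v" "u + v = 1" for x y u v
  proof -
    have "\<Phi> (u * x + v * y) \<le> ereal u * \<Phi> x + ereal v * \<Phi> y"
      using that assms(1) unfolding ereal_convex_def by blast
    moreover have "\<Phi> x \<noteq> \<infinity>" "\<Phi> y \<noteq> \<infinity>" using that by (auto simp: D_def)
    moreover have "\<Phi> z \<noteq> -\<infinity>" for z using assms(1) unfolding ereal_convex_def by blast
    ultimately show ?thesis
      by (cases "\<Phi> x"; cases "\<Phi> y"; cases "\<Phi> (u * x + v * y)") auto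
  qed
  show D: "convex D"
  proof (rule convexI)
    fix x y u v :: real assume "x \<in> D" "y \<in> D" "0 \<le> u" "0 \<le> v" "u + v = 1"
    moreover from this have "u * x + v * y \<in> S"
      using convexD[OF assms(2), of x y u v] by (auto simp: D_def)
    \<comment> \<open>\<open>ereal_convex\<close> speaks only of positive weights; with a zero
      weight the combination is one of the two points.\<close>
    ultimately show "u *\<^sub>R x + v *\<^sub>R y \<in> D"
      using *[of x y u v] by (cases "u = 0 \<or> v = 0") (auto simp: D_def)
  qed
  show "convex_on D (\<lambda>x. real_of_ereal (\<Phi> x))"
  proof (rule convex_onI[OF _ D])
    fix t x y :: real assume "0 < t" "t < 1" "x \<in> D" "y \<in> D"
    then show "real_of_ereal (\<Phi> ((1 - t) *\<^sub>R x + t *\<^sub>R y))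
        \<le> (1 - t) * real_of_ereal (\<Phi> x) + t * real_of_ereal (\<Phi> y)"
      using *[of x y "1 - t" t] by simp
  qed
qed

lemma convex_on_le_max:
  fixes f :: "real \<Rightarrow> real"
  assumes f: "convex_on S f" and "x \<in> S" "y \<in> S" "x \<le> z" "z \<le> y"
  shows "z \<in> S" and "f z \<le> max (f x) (f y)"
proof -
  have "z \<in> closed_segment x y"
    using assms by (simp add: closed_segment_eq_real_ivl)
  then obtain u where u: "0 \<le> u" "u \<le> 1" "z = (1 - u) *\<^sub>R x + u *\<^sub>R y"
    by (auto simp: closed_segment_def)
  have "convex S" using f by (rule convex_on_imp_convex)
  then show "z \<in> S"
    using assms u by (auto simp: convex_alt)
  show "f z \<le> max (f x) (f y)"
    unfolding u(3) using assms u by (intro convex_lower[OF f]) auto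
qed

text \<open>In one dimension, with \<open>s\<close> the slope of \<open>\<Phi>\<close> at the mean \<open>a\<close>, the function
  \<open>g x = exp (s * x - \<Phi> x)\<close> is unimodal with mode \<open>a\<close>. Integrating the derivative of
  \<open>(x - a) * exp ((c - s) * x - b * x\<^sup>2 / 2)\<close> against \<open>g\<close> gives \<open>0 \<le> (1 - b * A) * V\<close>.\<close>

lemma tilt_var_le_inverse:
  assumes "prob_space \<mu>" and sets: "sets \<mu> = sets borel" and supp: "AE x in \<mu>. x \<in> {-L..L}"
    and "log_concave_measure \<mu>" and b: "b > 0"
  shows "tilt_var \<mu> b c \<le> 1 / b"
  using \<open>log_concave_measure \<mu>\<close> unfolding log_concave_measure_def
proof (elim disjE exE conjE)
  fix x0 assume "\<mu> = return borel x0"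
  then show ?thesis using b by (simp add: tilt_var_return)
next
  fix \<Phi> assume conv: "ereal_convex \<Phi>"
    and \<mu>_eq: "\<mu> = density lborel (\<lambda>x. ennreal (exp_minus (\<Phi> x)))"
  interpret prob_space \<mu> by fact
  note \<mu> = \<open>prob_space \<mu>\<close> sets supp
  \<comment> \<open>Cutting the effective domain down to \<open>{-L..L}\<close> makes it bounded at
    once, and no mass is lost by \<open>supp\<close>.\<close>
  define D where "D = {x \<in> {-L..L}. \<Phi> x \<noteq> \<infinity>}"
  define \<phi> where "\<phi> x = real_of_ereal (\<Phi> x)" for x
  define f where "f x = exp_minus (\<Phi> x)" for x
  define w where "w x = exp (c * x - b * x\<^sup>2 / 2)" for x
  define a where "a = tilt_mean \<mu> b c"
  have D: "convex D" and \<phi>: "convex_on D \<phi>"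
    using ereal_convex_domain[OF conv, of "{-L..L}"] by (auto simp: D_def \<phi>_def[abs_def])
  have f_nonneg: "0 \<le> f x" for x
    by (simp add: f_def exp_minus_def)
  have f_D: "f x = exp (- \<phi> x)" if "x \<in> D" for x
    using that by (simp add: f_def exp_minus_def \<phi>_def D_def)
  \<comment> \<open>Measurability of the density is derived from the convexity of
    \<open>\<Phi>\<close>: the function exp(-\<Phi>) is quasiconcave.\<close>
  have [measurable]: "f \<in> borel_measurable borel"
  proof (rule borel_measurable_quasiconcave)
    fix x y z :: real assume "x \<le> z" "z \<le> y"
    show "min (f x) (f y) \<le> f z"
    proof (cases "\<Phi> x = \<infinity> \<or> \<Phi> y = \<infinity>")
      case True
      then show ?thesis using f_nonneg[of z] by (auto simp: f_def exp_minus_def)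
    next
      case False
      \<comment> \<open>The points \<open>x\<close> and \<open>y\<close> may lie outside
        \<open>{-L..L}\<close>, so the whole effective domain is taken here instead of
        \<open>D\<close>.\<close>
      define E where "E = {x. \<Phi> x \<noteq> \<infinity>}"
      have E: "convex E" and \<phi>E: "convex_on E \<phi>"
        using ereal_convex_domain[OF conv, of UNIV] by (auto simp: E_def \<phi>_def[abs_def])
      have xy: "x \<in> E" "y \<in> E" using False by (auto simp: E_def)
      have "\<phi> z \<le> max (\<phi> x) (\<phi> y)" "z \<in> E"
        using convex_on_le_max[OF \<phi>E xy \<open>x \<le> z\<close> \<open>z \<le> y\<close>] by auto
      then show ?thesis
        using xy by (auto simp: f_def exp_minus_def E_def \<phi>_def min_le_iff_disj le_max_iff_disj)
    qed
  qed
  have AE_D: "AE x in \<mu>. x \<in> D"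
  proof -
    have "AE x in \<mu>. \<Phi> x \<noteq> \<infinity>"
      unfolding \<mu>_eq f_def[symmetric]
    proof (subst AE_density)
      show "AE x in lborel. 0 < ennreal (f x) \<longrightarrow> \<Phi> x \<noteq> \<infinity>"
        by (auto simp: f_def exp_minus_def)
    qed simp
    with supp show ?thesis by eventually_elim (simp add: D_def)
  qed
  \<comment> \<open>A measure with a Lebesgue density has no atom, in particular none at its tilted
    mean.\<close>
  have AE_neq: "AE x in \<mu>. x \<noteq> a"
    unfolding \<mu>_eq f_def[symmetric]
    by (subst AE_density) (use AE_lborel_singleton[of a] in \<open>auto elim: eventually_mono\<close>)
  have w_pos: "0 < w x" for x by (simp add: w_def)
  have int: "integrable \<mu> w" "integrable \<mu> (\<lambda>x. (x - a) * w x)" 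
    "integrable \<mu> (\<lambda>x. (x - a)\<^sup>2 * w x)"
    unfolding w_def by (rule integrable_continuous_AE_Icc[OF \<mu>]; auto intro!: continuous_intros)+
  have centered: "(\<integral>x. (x - a) * w x \<partial>\<mu>) = 0"
    using integral_tilt_centered[OF \<mu>] by (simp add: w_def a_def)
  have second: "(\<integral>x. (x - a)\<^sup>2 * w x \<partial>\<mu>) = tilt_var \<mu> b c * tilt_V \<mu> b c"
    using tilt_var_eq[OF \<mu>] by (simp add: w_def a_def)
  have V: "tilt_V \<mu> b c = (\<integral>x. w x \<partial>\<mu>)"
    by (simp add: tilt_V_def w_def)
  \<comment> \<open>If \<open>D\<close> lay on one side of \<open>a\<close>, then
    \<open>(x - a) * w x\<close> would have a fixed sign and integral 0, hence vanish almost
    everywhere, although \<open>a\<close> is not an atom. Both sides together put \<open>a\<close>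
    in the interior of \<open>D\<close>, where \<open>\<phi>\<close> has a supporting line.\<close>
  have right: "\<exists>y\<in>D. a < y"
  proof (rule ccontr)
    assume "\<not> ?thesis"
    then have "AE x in \<mu>. 0 \<le> - ((x - a) * w x)"
      using AE_D w_pos by (auto elim!: eventually_mono simp: mult_le_0_iff not_less less_imp_le)
    with centered have "AE x in \<mu>. - ((x - a) * w x) = 0"
      using int(2) integral_nonneg_eq_0_iff_AE[of \<mu> "\<lambda>x. - ((x - a) * w x)"] by simp
    with AE_neq have "AE x in \<mu>. False"
      by eventually_elim (use w_pos in \<open>auto simp: less_le\<close>)
    then show False by simp
  qed
  have left: "\<exists>y\<in>D. y < a"
  proof (rule ccontr)
    assume "\<not> ?thesis"
    then have "AE x in \<mu>. 0 \<le> (x - a) * w x"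
      using AE_D w_pos by (auto elim!: eventually_mono simp: not_less less_imp_le)
    with centered have "AE x in \<mu>. (x - a) * w x = 0"
      using int(2) integral_nonneg_eq_0_iff_AE[of \<mu> "\<lambda>x. (x - a) * w x"] by simp
    with AE_neq have "AE x in \<mu>. False"
      by eventually_elim (use w_pos in \<open>auto simp: less_le\<close>)
    then show False by simp
  qed
  obtain y z where yz: "y \<in> D" "y < a" "z \<in> D" "a < z" using left right by blast
  have "{y<..<z} \<subseteq> D"
    using convex_on_le_max(1)[OF \<phi> yz(1,3)] by auto
  then have a_int: "a \<in> interior D"
    using yz by (intro interiorI[of "{y<..<z}"]) auto
  then have aD: "a \<in> D" using interior_subset by blast
  obtain s where s: "\<And>x. x \<in> D \<Longrightarrow> \<phi> a + s * (x - a) \<le> \<phi> x"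
    using convex_le_Inf_differential[OF \<phi> a_int] by blast
  define \<psi> where "\<psi> x = \<phi> x - s * x" for x
  have \<psi>: "convex_on D \<psi>"
    using \<phi> unfolding convex_on_def \<psi>_def by (simp add: algebra_simps)
  have \<psi>_min: "\<psi> a \<le> \<psi> x" if "x \<in> D" for x
    using s[OF that] by (simp add: \<psi>_def algebra_simps)
  define g where "g x = (if x \<in> D then exp (- \<psi> x) else 0)" for x
  \<comment> \<open>The exponent of \<open>H\<close> has derivative c - s - b x, which is
    \<open>k - b * (x - a)\<close>. This explains \<open>k\<close>, and the product rule then gives
    the factor \<open>q\<close>.\<close>
  define k where "k = c - s - b * a"
  define H where "H x = (x - a) * exp ((c - s) * x - b * x\<^sup>2 / 2)" for x
  define q where "q x = 1 + k * (x - a) - b * (x - a)\<^sup>2" for x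
  define h where "h x = q x * exp ((c - s) * x - b * x\<^sup>2 / 2)" for x
  have "0 \<le> (\<integral>x. h x * g x \<partial>lborel)"
  proof (rule integral_deriv_unimodal_nonneg[where H = H and a = a and l = "-L" and r = L])
    show "(H has_field_derivative h x) (at x)" for x
      unfolding H_def h_def q_def k_def
      by (auto intro!: derivative_eq_intros simp: algebra_simps power2_eq_square)
    show "continuous_on UNIV h"
      unfolding h_def q_def by (auto intro!: continuous_intros)
    show "g y \<le> g x" if "a \<le> x" "x \<le> y" for x y
      using convex_on_le_max[OF \<psi> aD _ that] \<psi>_min[of y] by (auto simp: g_def)
    show "g x \<le> g y" if "x \<le> y" "y \<le> a" for x y
      using convex_on_le_max[OF \<psi> _ aD that] \<psi>_min[of x] by (auto simp: g_def)
  qed (auto simp: H_def g_def D_def mult_le_0_iff)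
  \<comment> \<open>On \<open>D\<close> the slope \<open>s\<close> cancels between \<open>h\<close>
    and \<open>g\<close>. Off \<open>D\<close> the function \<open>g\<close> is 0, and
    \<open>f\<close> is 0 almost everywhere.\<close>
  also have "(\<integral>x. h x * g x \<partial>lborel) = (\<integral>x. f x * (q x * w x) \<partial>lborel)"
  proof (rule integral_cong_AE)
    have "AE x in lborel. 0 < ennreal (f x) \<longrightarrow> x \<in> D"
      using AE_D unfolding \<mu>_eq f_def[symmetric] by (subst (asm) AE_density) auto
    then show *: "AE x in lborel. h x * g x = f x * (q x * w x)"
    proof eventually_elim
      case (elim x)
      show ?case
      proof (cases "x \<in> D")
        case True
        have "exp ((c - s) * x - b * x\<^sup>2 / 2) * exp (- \<psi> x) = exp (- \<phi> x) * w x"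
          unfolding \<psi>_def w_def mult_exp_exp by (simp add: algebra_simps)
        then show ?thesis
          using True by (simp add: f_D g_def h_def)
      next
        case False
        then show ?thesis using elim f_nonneg[of x] by (simp add: g_def)
      qed
    qed
    have [measurable]: "D \<in> sets borel"
      using D by (intro real_interval_borel_measurable) (simp add: is_interval_convex_1)
    \<comment> \<open>Expressing \<open>g\<close> through \<open>f\<close> transfers measurability
      from the density.\<close>
    have "g = (\<lambda>x. indicator D x * (f x * exp (s * x)))"
      by (auto simp: g_def f_D \<psi>_def exp_add[symmetric])
    then show "(\<lambda>x. h x * g x) \<in> borel_measurable lborel"
      by (simp add: h_def q_def)
    show "(\<lambda>x. f x * (q x * w x)) \<in> borel_measurable lborel"
      by (simp add: w_def q_def)
  qed
  also have "\<dots> = (\<integral>x. q x * w x \<partial>\<mu>)"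
    unfolding \<mu>_eq f_def[symmetric]
    by (subst integral_density) (auto simp: f_nonneg q_def w_def)
  also have "\<dots> = (\<integral>x. w x + k * ((x - a) * w x) - b * ((x - a)\<^sup>2 * w x) \<partial>\<mu>)"
    by (simp add: q_def algebra_simps)
  \<comment> \<open>The term with \<open>k\<close> drops out because \<open>a\<close> is the tilted
    mean, so the value of \<open>s\<close> leaves no trace.\<close>
  also have "\<dots> = tilt_V \<mu> b c - b * (tilt_var \<mu> b c * tilt_V \<mu> b c)"
    using int centered second by (simp add: V)
  finally have "tilt_V \<mu> b c * (b * tilt_var \<mu> b c) \<le> tilt_V \<mu> b c * 1"
    by (simp add: algebra_simps)
  then have "b * tilt_var \<mu> b c \<le> 1"
    using tilt_V_pos[OF \<mu>, of b c] by simp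
  then show ?thesis using b by (simp add: field_simps)
qed

section \<open>The bound on the lifetime, path by path\<close>

theorem theorem1p7:
  fixes L :: real and \<mu> :: "real measure"
    and M :: "'a measure" and F :: "ennreal \<Rightarrow> 'a measure"
    and W :: "real \<Rightarrow> 'a \<Rightarrow> real" and T :: "'a \<Rightarrow> ennreal"
  assumes "L > 0"
    and "prob_space \<mu>" and "sets \<mu> = sets borel"
    and "log_concave_measure \<mu>"
    and "integrable \<mu> (\<lambda>x. x)" and "(\<integral>x. x \<partial>\<mu>) = 0"
    and "measure_support \<mu> \<subseteq> {-L..L}"
    and "filtered_prob_space M F" and "wiener_process M F W"
    and "solution_lifetime M F W \<mu> T"
  shows "AE \<omega> in M. T \<omega> \<le> ennreal (2 * L\<^sup>2)"
proof -
  have sets: "sets \<mu> = sets borel" by fact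
  have supp: "AE x in \<mu>. x \<in> {-L..L}"
    using \<open>measure_support \<mu> \<subseteq> {-L..L}\<close> by (rule AE_mem_of_measure_support_subset[OF sets])
  obtain b c where sol: "local_solution M F W \<mu> T b c"
    using \<open>solution_lifetime M F W \<mu> T\<close> unfolding solution_lifetime_def by blast
  have path: "\<forall>\<omega>\<in>space M. continuous_on {t. 0 \<le> t \<and> ennreal t < T \<omega>} (\<lambda>t. b t \<omega>) \<and>
      (\<forall>t\<ge>0. ennreal t < T \<omega> \<longrightarrow> 0 \<le> b t \<omega> \<and> 0 < tilt_var \<mu> (b t \<omega>) (c t \<omega>))"
    using sol unfolding local_solution_def by blast
  have "AE \<omega> in M. \<forall>t\<ge>0. ennreal t < T \<omega> \<longrightarrow>
      ((\<lambda>s. inverse ((tilt_var \<mu> (b s \<omega>) (c s \<omega>))\<^sup>2)) has_integral b t \<omega>) {0..t}"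
    using sol unfolding local_solution_def by blast
  with AE_space show ?thesis
  proof eventually_elim
    case (elim \<omega>)
    define A where "A t = tilt_var \<mu> (b t \<omega>) (c t \<omega>)" for t
    show ?case
    proof (rule ccontr)
      assume "\<not> T \<omega> \<le> ennreal (2 * L\<^sup>2)"
      \<comment> \<open>Strictness in the negated bound puts the closed interval, right endpoint
        included, inside the lifetime, as \<open>riccati_blow_up\<close> requires.\<close>
      then have T: "ennreal t < T \<omega>" if "t \<in> {0..2 * L\<^sup>2}" for t
        using that by (meson atLeastAtMost_iff ennreal_leI le_less_trans not_le)
      have b_nonneg: "0 \<le> b t \<omega>" and A_pos: "0 < A t" if "t \<in> {0..2 * L\<^sup>2}" for t
        using path elim(1) T[OF that] that by (auto simp: A_def)
      show False
      proof (rule riccati_blow_up[OF \<open>L > 0\<close>])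
        show "continuous_on {0..2 * L\<^sup>2} (\<lambda>t. b t \<omega>)"
          using path elim(1) T by (elim ballE[of _ _ \<omega>]) (auto elim!: continuous_on_subset)
        show "((\<lambda>s. inverse ((A s)\<^sup>2)) has_integral b t \<omega>) {0..t}" if "t \<in> {0..2 * L\<^sup>2}" for t
          using elim(2) T[OF that] that by (auto simp: A_def)
        fix t assume t: "t \<in> {0..2 * L\<^sup>2}"
        have "(A t)\<^sup>2 \<le> (L\<^sup>2)\<^sup>2"
          using A_pos[OF t] tilt_var_le_square[OF \<open>prob_space \<mu>\<close> sets supp]
          by (intro power_mono) (auto simp: A_def)
        then show "1 / L ^ 4 \<le> inverse ((A t)\<^sup>2)"
          using A_pos[OF t] by (simp add: divide_inverse le_imp_inverse_le)
        show "(b t \<omega>)\<^sup>2 \<le> inverse ((A t)\<^sup>2)"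
        \<comment> \<open>The bound A \<le> 1/b presupposes b > 0; for b = 0, as at time 0, the
          claim is trivial.\<close>
        proof (cases "b t \<omega> = 0")
          case False
          then have "A t \<le> 1 / b t \<omega>"
            using b_nonneg[OF t] \<open>log_concave_measure \<mu>\<close> unfolding A_def
            by (intro tilt_var_le_inverse[OF \<open>prob_space \<mu>\<close> sets supp]) auto
          then have "b t \<omega> \<le> inverse (A t)"
            using False b_nonneg[OF t] A_pos[OF t] by (simp add: field_simps)
          then have "(b t \<omega>)\<^sup>2 \<le> (inverse (A t))\<^sup>2"
            using b_nonneg[OF t] by (rule power_mono)
          then show ?thesis by (simp add: power_inverse)
        qed simp
      qed
    qed
  qed
qed

end
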